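(* Let $q=6+2\sqrt5$. The extremal $\sigma_q$-invariant polynomial $$\psi_5(x,y)=x^5-(50+20\sqrt5)x^3y^2+(225+100\sqrt5)xy^4$$ does not satisfy the Riemann hypothesis; that is, its zeta polynomial $P(T)$ (taken with respect to $q=6+2\sqrt5$) has a root $T\in\mathbf{C}$ with $|T|\neq 1/\sqrt{q}$.
   Context: For a matrix $\sigma=\begin{pmatrix} a&b\\ c&d\end{pmatrix}$ and $f\in\mathbf{C}[x,y]$ put $f^\sigma(x,y)=f(ax+by,cx+dy)$; $f$ is called $\sigma$-invariant if $f^\sigma=f$. For real $q>0$, $q\ne1$, let $\sigma_q=\frac{1}{\sqrt q}\begin{pmatrix}1&q-1\\1&-1\end{pmatrix}$. Consider homogeneous polynomials of the form $(\ast)$: $W(x,y)=x^n+\sum_{i=d}^n A_ix^{n-i}y^i$ with $A_i\in\mathbf{C}$, $A_d\neq0$ (so $d$ is the smallest positive exponent of $y$ that occurs). Zeta polynomial: for $W$ of the form $(\ast)$ (with $d\ge 2$, and with $d^\perp\ge2$, where $d^\perp$ is the corresponding number for $W^{\sigma_q}$; if $W$ is $\sigma_q$-invariant then $d^\perp=d$), there is a unique polynomial $P(T)\in\mathbf{C}[T]$ of degree at most $n-d$ such that, expanding as a power series in $T$, the coefficient of $T^{n-d}$ in $$\frac{P(T)}{(1-T)(1-qT)}\,(y(1-T)+xT)^n$$ equals $\dfrac{W(x,y)-x^n}{q-1}$. This $P(T)$ is the zeta polynomial of $W$ (with respect to $q$). Riemann hypothesis: a $\sigma_q$-invariant polynomial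 $W$ of the form $(\ast)$ satisfies the Riemann hypothesis if all roots of its zeta polynomial $P(T)$ lie on the circle $|T|=1/\sqrt q$. Extremality: let $q=6+2\sqrt5$, $\tau=\begin{pmatrix}1&0\\0&-1\end{pmatrix}$, and let $R_{6+2\sqrt5}$ be the ring of all $f\in\mathbf{C}[x,y]$ with $f^{\sigma_q}=f^\tau=f$. A polynomial $W\in R_{6+2\sqrt5}$ of the form $(\ast)$ and of odd degree $n$ is called extremal if its $d$ is the largest among all polynomials of the form $(\ast)$ of degree $n$ in $R_{6+2\sqrt5}$. For $\psi_5$ one has $n=5$, $d=2$; it is the only polynomial of the form $(\ast)$ of degree $5$ in $R_{6+2\sqrt5}$. *)

theory Defs
  imports "HOL-Analysis.Analysis" "HOL-Computational_Algebra.Computational_Algebra"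
begin

text \<open>
  The ring C[x,y] is rendered as C[x][y], i.e. as the type complex poly poly: the outer
  indeterminate is y and the coefficients are polynomials in x.
\<close>

type_synonym bipoly = "complex poly poly"

definition const_xy :: "complex \<Rightarrow> bipoly" where
  "const_xy c = [:[:c:]:]"

definition var_x :: bipoly where
  "var_x = [:[:0, 1:]:]"

definition var_y :: bipoly where
  "var_y = [:0, 1:]"

definition subst_xy :: "bipoly \<Rightarrow> bipoly \<Rightarrow> bipoly \<Rightarrow> bipoly" where
  "subst_xy f u v = poly (map_poly (\<lambda>p. poly (map_poly const_xy p) u) f) v"

definition act :: "bipoly \<Rightarrow> complex^2^2 \<Rightarrow> bipoly" where
  "act f s = subst_xy f
     (const_xy (s $ 1 $ 1) * var_x + const_xy (s $ 1 $ 2) * var_y)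
     (const_xy (s $ 2 $ 1) * var_x + const_xy (s $ 2 $ 2) * var_y)"

definition invariant :: "complex^2^2 \<Rightarrow> bipoly \<Rightarrow> bool" where
  "invariant s f \<longleftrightarrow> act f s = f"

definition sigma :: "real \<Rightarrow> complex^2^2" where
  "sigma q = (1 / sqrt q) *\<^sub>R
     vector [vector [1, complex_of_real (q - 1)],
             vector [1, - 1]]"

definition tau :: "complex^2^2" where
  "tau = vector [vector [1, 0], vector [0, - 1]]"

text \<open>
  The shape \<open>x^n + A_d x^(n-d) y^d + \<dots> + A_n y^n\<close> with nonzero \<open>A_d\<close>;
  the requirement \<open>d \<ge> 1\<close> makes \<open>d\<close> the smallest positive exponent of y that occurs.
\<close>

definition enumerator_form :: "nat \<Rightarrow> nat \<Rightarrow> bipoly \<Rightarrow> bool" where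
  "enumerator_form n d W \<longleftrightarrow> 1 \<le> d \<and> d \<le> n \<and>
     (\<exists>A :: nat \<Rightarrow> complex. A d \<noteq> 0 \<and>
        W = var_x ^ n + (\<Sum>i = d..n. const_xy (A i) * var_x ^ (n - i) * var_y ^ i))"

text \<open>
  The generating series in T over C[x,y]. Since \<open>P(T) / ((1 - T)(1 - q T))\<close> only involves
  scalars, the quotient is formed in C[[T]] and then embedded coefficientwise.
\<close>

definition zeta_series :: "real \<Rightarrow> nat \<Rightarrow> complex poly \<Rightarrow> bipoly fps" where
  "zeta_series q n P =
     Abs_fps (\<lambda>m. const_xy (fps_nth
        (fps_of_poly P / ((1 - fps_X) * (1 - fps_const (complex_of_real q) * fps_X))) m))
     * (fps_const var_y * (1 - fps_X) + fps_const var_x * fps_X) ^ n"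

text \<open>
  In the next definition \<open>d'\<close> is the exponent belonging to the transform of \<open>W\<close> under \<open>sigma q\<close>.
\<close>

definition is_zeta_polynomial :: "real \<Rightarrow> bipoly \<Rightarrow> complex poly \<Rightarrow> bool" where
  "is_zeta_polynomial q W P \<longleftrightarrow>
     (\<exists>n d d'. enumerator_form n d W \<and> 2 \<le> d \<and>
        enumerator_form n d' (act W (sigma q)) \<and> 2 \<le> d' \<and>
        degree P \<le> n - d \<and>
        fps_nth (zeta_series q n P) (n - d) =
          const_xy (1 / complex_of_real (q - 1)) * (W - var_x ^ n))"

definition zeta_polynomial :: "real \<Rightarrow> bipoly \<Rightarrow> complex poly" where
  "zeta_polynomial q W = (THE P. is_zeta_polynomial q W P)"

definition satisfies_RH :: "real \<Rightarrow> bipoly \<Rightarrow> bool" where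
  "satisfies_RH q W \<longleftrightarrow>
     (\<forall>T. poly (zeta_polynomial q W) T = 0 \<longrightarrow> cmod T = 1 / sqrt q)"

definition q0 :: real where
  "q0 = 6 + 2 * sqrt 5"

definition R_q0 :: "bipoly set" where
  "R_q0 = {f. invariant (sigma q0) f \<and> invariant tau f}"

definition extremal :: "bipoly \<Rightarrow> bool" where
  "extremal W \<longleftrightarrow> W \<in> R_q0 \<and>
     (\<exists>n d. odd n \<and> enumerator_form n d W \<and>
        (\<forall>V d'. V \<in> R_q0 \<and> enumerator_form n d' V \<longrightarrow> d' \<le> d))"

definition psi5 :: bipoly where
  "psi5 = var_x ^ 5
     - const_xy (complex_of_real (50 + 20 * sqrt 5)) * var_x ^ 3 * var_y ^ 2
     + const_xy (complex_of_real (225 + 100 * sqrt 5)) * var_x * var_y ^ 4"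

end

(*
  Evaluation at points of C^2 turns identities in C[x,y] into identities of complex numbers.
  Substituting (1,1) and (1-q,1) into the invariance under sigma_q shows that no invariant
  x^5 + A x y^4 exists, so d = 2 is extremal in degree 5. Comparing coefficients in the defining
  equation determines the zeta polynomial uniquely as
  P(T) = -1 + (4 + 2 sqrt 5) T + (14 + 6 sqrt 5) T^2 - (16 + 8 sqrt 5) T^3.
  In U = T sqrt q it is -(U + 1) (U^2 - m U + 1) with m = (5 + sqrt 5) / 2 > 2, and the quadratic
  factor has two distinct positive real roots with product 1, hence one off the unit circle.
*)

theory Submission
  imports Defs
begin

section \<open>Evaluation of elements of C[x,y] at points of C^2\<close>

definition ev :: "bipoly \<Rightarrow> complex \<Rightarrow> complex \<Rightarrow> complex" where
  "ev f a b = poly (poly f [:b:]) a"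

lemma ev_simps [simp]:
  "ev (f + g) a b = ev f a b + ev g a b"
  "ev (f - g) a b = ev f a b - ev g a b"
  "ev (f * g) a b = ev f a b * ev g a b"
  "ev (f ^ k) a b = ev f a b ^ k"
  "ev 1 a b = 1"
  "ev (of_nat m) a b = of_nat m"
  "ev (const_xy c) a b = c"
  "ev var_x a b = a"
  "ev var_y a b = b"
  by (simp_all add: ev_def const_xy_def var_x_def var_y_def)

lemma ev_sum [simp]: "ev (sum f S) a b = (\<Sum>i\<in>S. ev (f i) a b)"
  by (simp add: ev_def poly_sum)

text \<open>C[x] is an infinite integral domain: equality at all points makes every constant
  \<open>[:b:]\<close> a root of \<open>f - g\<close>, viewed as a polynomial in y over C[x], and a
  nonzero polynomial has only finitely many roots.\<close>

lemma bipoly_eqI: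
  assumes "\<And>a b. ev f a b = ev g a b"
  shows "f = g"
proof -
  have "poly f [:b:] = poly g [:b:]" for b
    using assms by (simp add: ev_def poly_eq_poly_eq_iff [symmetric] fun_eq_iff)
  then have "range (\<lambda>b. [:b:]) \<subseteq> {p. poly (f - g) p = 0}"
    by auto
  moreover have "infinite (range (\<lambda>b :: complex. [:b:]))"
    by (simp add: finite_image_iff inj_on_def infinite_UNIV_char_0)
  ultimately have "infinite {p. poly (f - g) p = 0}"
    using finite_subset by blast
  then show ?thesis
    using poly_roots_finite [of "f - g"] by auto
qed

lemma ev_poly_const_xy: "ev (poly (map_poly const_xy p) u) a b = poly p (ev u a b)"
  by (induction p) (simp_all add: map_poly_pCons const_xy_def, simp_all add: ev_def)

lemma ev_subst_xy: "ev (subst_xy f u v) a b = ev f (ev u a b) (ev v a b)"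
proof (induction f)
  case 0
  show ?case by (simp add: subst_xy_def ev_def)
next
  case (pCons p f)
  have "subst_xy (pCons p f) u v = poly (map_poly const_xy p) u + v * subst_xy f u v"
    by (simp add: subst_xy_def map_poly_pCons)
  moreover have "ev (pCons p f) c d = poly p c + d * ev f c d" for c d
    by (simp add: ev_def)
  ultimately show ?case
    using pCons.IH by (simp add: ev_poly_const_xy)
qed

text \<open>Reduces the action of a matrix to a linear change of the evaluation point, so invariance
  can be tested pointwise.\<close>

lemma ev_act:
  "ev (act f s) a b = ev f (s $ 1 $ 1 * a + s $ 1 $ 2 * b) (s $ 2 $ 1 * a + s $ 2 $ 2 * b)"
  by (simp add: act_def ev_subst_xy)

lemma ev_act_tau: "ev (act f tau) a b = ev f a (- b)"
  by (simp add: ev_act tau_def)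

section \<open>Arithmetic in Q(sqrt 5) and the action of \<open>sigma q0\<close>\<close>

lemma sqrt_q0: "sqrt q0 = 1 + sqrt 5"
  by (rule real_sqrt_unique) (simp_all add: q0_def power2_eq_square algebra_simps)

text \<open>An opaque complex constant, so that simplification computes in Q(sqrt 5) through
  \<open>sqrt5_mult_self\<close>.\<close>

definition sqrt5 :: complex where
  "sqrt5 = complex_of_real (sqrt 5)"

lemma of_real_sqrt_5 [simp]: "complex_of_real (sqrt 5) = sqrt5"
  by (simp add: sqrt5_def)

lemma sqrt5_mult_self: "sqrt5 * sqrt5 = 5" "sqrt5 * (sqrt5 * c) = 5 * c"
proof -
  show "sqrt5 * sqrt5 = 5"
    by (simp add: sqrt5_def del: of_real_sqrt_5 flip: of_real_mult)
  then show "sqrt5 * (sqrt5 * c) = 5 * c"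
    by (simp flip: mult.assoc)
qed

lemmas sqrt5_expand =
  add_divide_distrib diff_divide_distrib algebra_simps eval_nat_numeral sqrt5_mult_self

lemma inverse_sqrt_q0: "1 / sqrt q0 = (sqrt 5 - 1) / 4"
proof -
  have "1 + sqrt 5 > (0::real)"
    by (simp add: add_pos_pos)
  then show ?thesis
    by (simp add: sqrt_q0 field_simps)
qed

text \<open>All entries of \<open>sigma q0\<close> lie in Q(sqrt 5), because \<open>q0\<close> is
  the square of 1 + sqrt 5; the upper right entry is (5 + 2 sqrt 5)(sqrt 5 - 1) / 4.\<close>

lemma ev_act_sigma:
  "ev (act f (sigma q0)) a b =
     ev f ((sqrt5 - 1) / 4 * a + (5 + 3 * sqrt5) / 4 * b) ((sqrt5 - 1) / 4 * (a - b))"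
proof -
  have "complex_of_real (sqrt 5 - 1) / 4 * complex_of_real (q0 - 1) = (5 + 3 * sqrt5) / 4"
    by (simp add: q0_def sqrt5_expand)
  then have "((sqrt 5 - 1) / 4) *\<^sub>R complex_of_real (q0 - 1) = (5 + 3 * sqrt5) / 4"
    by (simp only: scaleR_conv_of_real of_real_divide of_real_numeral)
  then show ?thesis
    unfolding ev_act sigma_def inverse_sqrt_q0 vector_scaleR_component vector_2
    by (simp only:) (simp add: scaleR_conv_of_real diff_divide_distrib algebra_simps)
qed

section \<open>Invariance and shape of \<open>psi5\<close>\<close>

lemma ev_psi5:
  "ev psi5 a b = a ^ 5 - (50 + 20 * sqrt5) * a ^ 3 * b ^ 2 + (225 + 100 * sqrt5) * a * b ^ 4"
  by (simp add: psi5_def)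

text \<open>After division by x, \<open>psi5\<close> is quadratic in x^2 and y^2, with roots x^2 /
  y^2 equal to 5 and 45 + 20 sqrt 5 = (5 + 2 sqrt 5)^2.\<close>

lemma ev_psi5_factored:
  "ev psi5 a b =
    a * (a - (5 + 2 * sqrt5) * b) * (a + (5 + 2 * sqrt5) * b) * (a - sqrt5 * b) * (a + sqrt5 * b)"
  unfolding ev_psi5 by (simp add: sqrt5_expand)

text \<open>
  The reflection \<open>sigma q0\<close> permutes the five linear factors of \<open>psi5\<close> up to scalars with
  product 1; this avoids expanding fifth powers.
\<close>

lemma ev_psi5_permuted:
  assumes "u = r1 * (a + (5 + 2 * sqrt5) * b)"
    and "u - (5 + 2 * sqrt5) * v = r2 * (a - sqrt5 * b)"
    and "u + (5 + 2 * sqrt5) * v = r3 * a"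
    and "u - sqrt5 * v = r4 * (a - (5 + 2 * sqrt5) * b)"
    and "u + sqrt5 * v = a + sqrt5 * b"
    and "r1 * r2 * r3 * r4 = 1"
  shows "ev psi5 u v = ev psi5 a b"
proof -
  have "ev psi5 u v = (r1 * r2 * r3 * r4) * ev psi5 a b"
    unfolding ev_psi5_factored assms(2-5) unfolding assms(1) by (simp only: mult_ac)
  then show ?thesis
    using assms(6) by simp
qed

text \<open>With k = 5 + 2 sqrt 5, the transformation swaps x with x + k y and x - k y with x - sqrt
  5 y up to scalars, and fixes x + sqrt 5 y.\<close>

lemma act_sigma_psi5: "act psi5 (sigma q0) = psi5"
proof (rule bipoly_eqI)
  fix a b
  define u where "u = (sqrt5 - 1) / 4 * a + (5 + 3 * sqrt5) / 4 * b"
  define v where "v = (sqrt5 - 1) / 4 * (a - b)"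
  have "u = (sqrt5 - 1) / 4 * (a + (5 + 2 * sqrt5) * b)"
    unfolding u_def by (simp add: sqrt5_expand)
  moreover have "u - (5 + 2 * sqrt5) * v = - (3 + sqrt5) / 2 * (a - sqrt5 * b)"
    unfolding u_def v_def by (simp add: sqrt5_expand)
  moreover have "u + (5 + 2 * sqrt5) * v = (1 + sqrt5) * a"
    unfolding u_def v_def by (simp add: sqrt5_expand)
  moreover have "u - sqrt5 * v = - (3 - sqrt5) / 2 * (a - (5 + 2 * sqrt5) * b)"
    unfolding u_def v_def by (simp add: sqrt5_expand)
  moreover have "u + sqrt5 * v = a + sqrt5 * b"
    unfolding u_def v_def by (simp add: sqrt5_expand)
  \<comment> \<open>The scalars of each swapped pair are inverse to each other, as
    \<open>sigma q0\<close> is an involution.\<close>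
  moreover have "(sqrt5 - 1) / 4 * (- (3 + sqrt5) / 2) * (1 + sqrt5) * (- (3 - sqrt5) / 2) = 1"
    by (simp add: sqrt5_expand)
  ultimately have "ev psi5 u v = ev psi5 a b"
    by (rule ev_psi5_permuted)
  then show "ev (act psi5 (sigma q0)) a b = ev psi5 a b"
    by (simp add: ev_act_sigma u_def v_def)
qed

lemma psi5_in_R_q0: "psi5 \<in> R_q0"
  unfolding R_q0_def invariant_def mem_Collect_eq
  by (intro conjI act_sigma_psi5 bipoly_eqI) (simp add: ev_act_tau ev_psi5)

lemma enumerator_form_psi5: "enumerator_form 5 2 psi5"
proof -
  define A :: "nat \<Rightarrow> complex" where
    "A i = (if i = 2 then - (50 + 20 * sqrt5) else if i = 4 then 225 + 100 * sqrt5 else 0)" for i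
  \<comment> \<open>Nonvanishing comes from positivity, which is available for the real number and
    then carried over to C.\<close>
  have "50 + 20 * sqrt 5 > 0"
    by (simp add: add_pos_pos)
  then have "complex_of_real (50 + 20 * sqrt 5) \<noteq> 0"
    by (simp only: of_real_eq_0_iff)
  then have "50 + 20 * sqrt5 \<noteq> 0"
    by simp
  then have "A 2 \<noteq> 0"
    by (simp only: A_def refl if_True neg_equal_0_iff_equal not_False_eq_True)
  moreover have "psi5 = var_x ^ 5 + (\<Sum>i = 2..5. const_xy (A i) * var_x ^ (5 - i) * var_y ^ i)"
    by (rule bipoly_eqI) (simp add: ev_psi5 A_def eval_nat_numeral sum.atLeast_Suc_atMost algebra_simps)
  ultimately show ?thesis
    unfolding enumerator_form_def by auto
qed

section \<open>Extremality in degree 5\<close>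

lemma enumerator_form_ev:
  assumes "enumerator_form n d W"
  obtains A where "\<And>a b. ev W a b = a ^ n + (\<Sum>i = d..n. A i * a ^ (n - i) * b ^ i)"
  using assms by (auto simp: enumerator_form_def)

lemma enumerator_form_5_le_2:
  assumes V: "V \<in> R_q0" and form: "enumerator_form 5 d V"
  shows "d \<le> 2"
proof (rule ccontr)
  assume "\<not> d \<le> 2"
  moreover have "d \<le> 5"
    using form by (simp add: enumerator_form_def)
  ultimately consider "d = 3" | "d = 4" | "d = 5"
    by linarith
  moreover obtain A where A: "\<And>a b. ev V a b = a ^ 5 + (\<Sum>i = d..5. A i * a ^ (5 - i) * b ^ i)"
    using enumerator_form_ev [OF form] by metis
  \<comment> \<open>The three possible values of \<open>d\<close> are merged by allowing zero
    coefficients.\<close>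
  ultimately obtain A3 A4 A5 where
    ev: "\<And>a b. ev V a b = a ^ 5 + A3 * a ^ 2 * b ^ 3 + A4 * a * b ^ 4 + A5 * b ^ 5"
  proof cases
    case 1
    with A that [of "A 3" "A 4" "A 5"] show ?thesis
      by (simp add: eval_nat_numeral sum.atLeast_Suc_atMost algebra_simps)
  next
    case 2
    with A that [of 0 "A 4" "A 5"] show ?thesis
      by (simp add: eval_nat_numeral sum.atLeast_Suc_atMost algebra_simps)
  next
    case 3
    with A that [of 0 0 "A 5"] show ?thesis
      by (simp add: eval_nat_numeral sum.atLeast_Suc_atMost algebra_simps)
  qed
  have tau: "ev V a (- b) = ev V a b" for a b
    using V ev_act_tau [of V a b] by (simp add: R_q0_def invariant_def)
  have sigma: "ev V ((sqrt5 - 1) / 4 * a + (5 + 3 * sqrt5) / 4 * b) ((sqrt5 - 1) / 4 * (a - b)) = ev V a b"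
    for a b
    using V ev_act_sigma [of V a b] by (simp add: R_q0_def invariant_def)
  \<comment> \<open>Invariance under \<open>tau\<close> leaves no odd powers of y; two points
    suffice to separate the two coefficients.\<close>
  have "A3 + A5 = 0" "4 * A3 + A5 = 0"
    using tau [of 1 1] tau [of 2 1] by (simp_all add: ev eq_neg_iff_add_eq_0 algebra_simps)
       (algebra)+
  then have "A3 = 0" "A5 = 0"
    by algebra+
  \<comment> \<open>The point (1,1) is sent to (sqrt q0, 0), where only x^5 survives.\<close>
  have "(sqrt5 - 1) / 4 * 1 + (5 + 3 * sqrt5) / 4 * 1 = 1 + sqrt5"
    by (simp add: field_simps)
  then have "A4 = (1 + sqrt5) ^ 5 - 1"
    using sigma [of 1 1] by (simp add: ev \<open>A3 = 0\<close> \<open>A5 = 0\<close> algebra_simps)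
  \<comment> \<open>Here \<open>k\<close> is q0 - 1. The point (-k, 1) is sent to the line x = 0, on
    which x^5 + A4 x y^4 vanishes.\<close>
  moreover have "k ^ 5 + k * A4 = 0" if k: "k = 5 + 2 * sqrt5" for k
  proof -
    have "(sqrt5 - 1) / 4 * - k + (5 + 3 * sqrt5) / 4 * 1 = 0"
      by (simp add: k sqrt5_expand)
    then have "ev V (- k) 1 = 0"
      using sigma [of "- k" 1] by (simp only: ev \<open>A3 = 0\<close> \<open>A5 = 0\<close>) simp
    then show ?thesis
      by (simp add: ev \<open>A3 = 0\<close> \<open>A5 = 0\<close> algebra_simps) (simp add: neg_eq_iff_add_eq_0)
  qed
  \<comment> \<open>Eliminating \<open>A4\<close> makes a real number vanish that is a positive term
    plus a nonnegative one.\<close>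
  ultimately have "complex_of_real ((5 + 2 * sqrt 5) ^ 5 + (5 + 2 * sqrt 5) * ((1 + sqrt 5) ^ 5 - 1)) = 0"
    by simp
  then have "(5 + 2 * sqrt 5) ^ 5 + (5 + 2 * sqrt 5) * ((1 + sqrt 5) ^ 5 - 1) = 0"
    using of_real_eq_0_iff by blast
  moreover have "(1 + sqrt 5) ^ 5 \<ge> 1"
    by (rule one_le_power) simp
  moreover have "(5 + 2 * sqrt 5) > 0"
    by (simp add: add_pos_pos)
  ultimately show False
    by (smt (verit) mult_nonneg_nonneg zero_less_power)
qed

lemma extremal_psi5: "extremal psi5"
  unfolding extremal_def using psi5_in_R_q0 enumerator_form_psi5 enumerator_form_5_le_2
  by (intro conjI exI [of _ 5] exI [of _ 2]) auto

text \<open>Pins down the degree and the exponents that \<open>is_zeta_polynomial\<close> quantifies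
  existentially.\<close>

lemma enumerator_form_psi5_iff:
  assumes "2 \<le> d"
  shows "enumerator_form n d psi5 \<longleftrightarrow> n = 5 \<and> d = 2"
proof
  assume form: "enumerator_form n d psi5"
  obtain A where A: "\<And>a b. ev psi5 a b = a ^ n + (\<Sum>i = d..n. A i * a ^ (n - i) * b ^ i)"
    using enumerator_form_ev [OF form] by blast
  \<comment> \<open>At (2,0) every term with a positive power of y drops out, leaving 2 to the
    degree.\<close>
  have "(2 :: complex) ^ 5 = 2 ^ n"
    using A [of 2 0] assms by (simp add: ev_psi5 power_0_left)
  then have "(2 :: nat) ^ 5 = 2 ^ n"
    by (metis of_nat_eq_iff of_nat_numeral of_nat_power)
  then have "n = 5"
    by (subst (asm) power_inject_exp) simp_all
  then show "n = 5 \<and> d = 2"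
    using assms form enumerator_form_5_le_2 [OF psi5_in_R_q0] by force
qed (use enumerator_form_psi5 in simp)

section \<open>The generating series and the zeta polynomial of \<open>psi5\<close>\<close>

lemma fps_nth_linear_power:
  fixes a b :: "'a :: comm_ring_1"
  shows "fps_nth ((fps_const a + fps_const b * fps_X) ^ n) k = of_nat (n choose k) * a ^ (n - k) * b ^ k"
proof -
  have "(fps_const a + fps_const b * fps_X) ^ n = fps_of_poly ([:a, b:] ^ n)"
    by (simp add: fps_of_poly_power fps_of_poly_pCons)
  then have "fps_nth ((fps_const a + fps_const b * fps_X) ^ n) k = coeff ([:a, b:] ^ n) k"
    by (simp only: fps_of_poly_nth)
  \<comment> \<open>Beyond \<open>n\<close> the truncated exponent \<open>n - k\<close> is harmless,
    since the binomial coefficient is zero as well.\<close>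
  moreover have "coeff ([:a, b:] ^ n) k = 0" if "k > n"
  proof (rule coeff_eq_0)
    have "degree ([:a, b:] ^ n) \<le> 1 * n"
      by (rule order_trans [OF degree_power_le]) simp
    with that show "degree ([:a, b:] ^ n) < k"
      by simp
  qed
  ultimately show ?thesis
    by (cases "k \<le> n") (simp_all only: coeff_linear_poly_power mult_ac not_le
        binomial_eq_0 of_nat_0 mult_zero_left mult_zero_right)
qed

definition zeta_denominator :: "complex fps" where
  "zeta_denominator = (1 - fps_X) * (1 - fps_const (complex_of_real q0) * fps_X)"

definition zeta_quotient :: "complex poly \<Rightarrow> nat \<Rightarrow> complex" where
  "zeta_quotient P = fps_nth (fps_of_poly P / zeta_denominator)"

text \<open>Multiplying back by the denominator 1 - (1 + q) T + q T^2, a unit of C[[T]], gives a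
  triangular relation between the coefficients of P and those of the quotient.\<close>

lemma coeff_zeta_quotient:
  fixes P
  defines "c \<equiv> zeta_quotient P"
  shows "coeff P 0 = c 0"
    "coeff P 1 = c 1 - (7 + 2 * sqrt5) * c 0"
    "coeff P 2 = c 2 - (7 + 2 * sqrt5) * c 1 + (6 + 2 * sqrt5) * c 0"
    "coeff P 3 = c 3 - (7 + 2 * sqrt5) * c 2 + (6 + 2 * sqrt5) * c 1"
proof -
  define F where "F = fps_of_poly P / zeta_denominator"
  have "fps_nth zeta_denominator 0 \<noteq> 0"
    by (simp add: zeta_denominator_def)
  then have "fps_of_poly P = F * zeta_denominator"
    unfolding F_def by (metis dvd_div_mult_self fps_is_unit_iff unit_imp_dvd)
  moreover have "zeta_denominator = fps_of_poly [:1, - (7 + 2 * sqrt5), 6 + 2 * sqrt5:]"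
    by (simp add: zeta_denominator_def q0_def fps_of_poly_pCons algebra_simps
        flip: fps_const_add fps_const_mult fps_const_neg)
  ultimately have "coeff P k = fps_nth (F * fps_of_poly [:1, - (7 + 2 * sqrt5), 6 + 2 * sqrt5:]) k" for k
    by (metis fps_of_poly_nth)
  then show "coeff P 0 = c 0"
    "coeff P 1 = c 1 - (7 + 2 * sqrt5) * c 0"
    "coeff P 2 = c 2 - (7 + 2 * sqrt5) * c 1 + (6 + 2 * sqrt5) * c 0"
    "coeff P 3 = c 3 - (7 + 2 * sqrt5) * c 2 + (6 + 2 * sqrt5) * c 1"
    unfolding c_def zeta_quotient_def F_def [symmetric]
    by (simp_all add: fps_mult_nth eval_nat_numeral algebra_simps)
qed

text \<open>Since y (1 - T) + x T = y + (x - y) T, the coefficient of T^3 is a convolution with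
  binomial terms; here n - d = 5 - 2 = 3.\<close>

lemma ev_zeta_series:
  fixes P
  defines "c \<equiv> zeta_quotient P"
  shows "ev (fps_nth (zeta_series q0 5 P) 3) a b =
    c 3 * b ^ 5 + 5 * c 2 * b ^ 4 * (a - b) + 10 * c 1 * b ^ 3 * (a - b) ^ 2
      + 10 * c 0 * b ^ 2 * (a - b) ^ 3"
proof -
  have "fps_const var_y * (1 - fps_X) + fps_const var_x * fps_X
      = fps_const var_y + fps_const (var_x - var_y) * fps_X"
    by (simp add: algebra_simps flip: fps_const_sub)
  then have "fps_nth (zeta_series q0 5 P) 3
      = (\<Sum>i = 0..3. const_xy (c i) *
          (of_nat (5 choose (3 - i)) * var_y ^ (5 - (3 - i)) * (var_x - var_y) ^ (3 - i)))"
    unfolding zeta_series_def zeta_denominator_def [symmetric]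
    by (simp only: fps_mult_nth fps_nth_linear_power c_def zeta_quotient_def fps_nth_Abs_fps)
  then have "ev (fps_nth (zeta_series q0 5 P) 3) a b
      = (\<Sum>i = 0..3. c i * (of_nat (5 choose (3 - i)) * b ^ (5 - (3 - i)) * (a - b) ^ (3 - i)))"
    by (simp only: ev_sum ev_simps)
  then show ?thesis
    by (simp only:) (simp add: sum.atLeast_Suc_atMost eval_nat_numeral mult_ac)
qed

lemma zeta_equation_iff:
  "fps_nth (zeta_series q0 5 P) 3 = const_xy (1 / complex_of_real (q0 - 1)) * (psi5 - var_x ^ 5)
    \<longleftrightarrow> coeff P 0 = - 1 \<and> coeff P 1 = 4 + 2 * sqrt5 \<and> coeff P 2 = 14 + 6 * sqrt5
      \<and> coeff P 3 = - (16 + 8 * sqrt5)" (is "?L = ?R \<longleftrightarrow> ?coeffs")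
proof -
  define c where "c = zeta_quotient P"
  have "5 + 2 * sqrt 5 > 0"
    by (simp add: add_pos_pos)
  then have "complex_of_real (5 + 2 * sqrt 5) \<noteq> 0"
    by (simp only: of_real_eq_0_iff)
  then have q: "5 + 2 * sqrt5 \<noteq> 0"
    by simp
  \<comment> \<open>Both coefficients of \<open>psi5\<close> are divisible by q0 - 1 = 5 + 2 sqrt 5
    with quotients in Z[sqrt 5].\<close>
  have R: "ev ?R a b = - 10 * a ^ 3 * b ^ 2 + (25 + 10 * sqrt5) * a * b ^ 4" for a b
  proof -
    have "complex_of_real (q0 - 1) = 5 + 2 * sqrt5"
      by (simp add: q0_def)
    then have "(5 + 2 * sqrt5) * ev ?R a b = ev psi5 a b - a ^ 5"
      using q by (simp only: ev_simps) simp
    also have "\<dots> = (5 + 2 * sqrt5) * (- 10 * a ^ 3 * b ^ 2 + (25 + 10 * sqrt5) * a * b ^ 4)"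
      unfolding ev_psi5 by (simp add: algebra_simps sqrt5_mult_self)
    finally show ?thesis
      using q by (simp only: mult_cancel_left simp_thms)
  qed
  have "?L = ?R \<longleftrightarrow> c 0 = - 1 \<and> c 1 = - 3 \<and> c 2 = 2 * sqrt5 - 1 \<and> c 3 = 15 + 10 * sqrt5" (is "_ \<longleftrightarrow> ?cs")
  proof
    assume "?L = ?R"
    then have "c 3 * b ^ 5 + 5 * c 2 * b ^ 4 * (a - b) + 10 * c 1 * b ^ 3 * (a - b) ^ 2
      + 10 * c 0 * b ^ 2 * (a - b) ^ 3 = - 10 * a ^ 3 * b ^ 2 + (25 + 10 * sqrt5) * a * b ^ 4" for a b
      using R ev_zeta_series [of P] by (simp add: c_def)
    \<comment> \<open>The first variable to occur is \<open>b\<close>, so these are the points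
      (1,1), (2,1), (0,1), (-1,1). With y = 1 both sides are polynomials in x of degree at most 3,
      which four points determine.\<close>
    from this [of 1 1] this [of 1 2] this [of 1 0] this [of 1 "- 1"]
    have eqs: "c 3 = 15 + 10 * sqrt5" "c 3 + 5 * c 2 + 10 * c 1 + 10 * c 0 = - 30 + 20 * sqrt5"
      "c 3 - 5 * c 2 + 10 * c 1 - 10 * c 0 = 0" "c 3 - 10 * c 2 + 40 * c 1 - 80 * c 0 = - 15 - 10 * sqrt5"
      by (simp_all add: algebra_simps)
    have "c 1 = - 3"
      using eqs(1-3) by algebra
    moreover from this have "c 2 + c 0 = 2 * sqrt5 - 2" "2 * c 2 + 16 * c 0 = 4 * sqrt5 - 18"
      using eqs by algebra+
    then have "c 0 = - 1"
      by algebra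
    moreover from this have "c 2 = 2 * sqrt5 - 1"
      using \<open>c 2 + c 0 = 2 * sqrt5 - 2\<close> by (simp add: algebra_simps)
    ultimately show ?cs
      using eqs(1) by simp
  next
    assume ?cs
    show "?L = ?R"
    proof (rule bipoly_eqI)
      fix a b
      from \<open>?cs\<close> show "ev ?L a b = ev ?R a b"
        unfolding R ev_zeta_series c_def [symmetric]
        by (simp only:) (simp add: eval_nat_numeral algebra_simps)
    qed
  qed
  also have "\<dots> \<longleftrightarrow> ?coeffs"
  proof
    assume ?cs
    then show ?coeffs
      unfolding coeff_zeta_quotient c_def [symmetric]
      by (simp only:) (simp add: algebra_simps sqrt5_mult_self)
  next
    assume coeffs: ?coeffs
    \<comment> \<open>The triangular relation solved for the series coefficients, from the lowest
      upwards.\<close>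
    have c: "c 0 = coeff P 0" "c 1 = coeff P 1 + (7 + 2 * sqrt5) * c 0"
      "c 2 = coeff P 2 + (7 + 2 * sqrt5) * c 1 - (6 + 2 * sqrt5) * c 0"
      "c 3 = coeff P 3 + (7 + 2 * sqrt5) * c 2 - (6 + 2 * sqrt5) * c 1"
      unfolding coeff_zeta_quotient c_def by simp_all
    have c0: "c 0 = - 1"
      using coeffs by (simp add: c(1))
    have c1: "c 1 = - 3"
      unfolding c(2) c0 using coeffs by simp
    have c2: "c 2 = 2 * sqrt5 - 1"
      unfolding c(3) c0 c1 using coeffs by simp
    have "coeff P 3 = - (16 + 8 * sqrt5)"
      using coeffs by blast
    then have "c 3 = 15 + 10 * sqrt5"
      unfolding c(4) c1 c2 by (simp only:) (simp add: algebra_simps sqrt5_mult_self)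
    with c0 c1 c2 show ?cs
      by simp
  qed
  finally show ?thesis .
qed

definition zeta_psi5 :: "complex poly" where
  "zeta_psi5 = [:- 1, 4 + 2 * sqrt5, 14 + 6 * sqrt5, - (16 + 8 * sqrt5):]"

lemma is_zeta_polynomial_psi5_iff: "is_zeta_polynomial q0 psi5 P \<longleftrightarrow> P = zeta_psi5"
proof -
  have "is_zeta_polynomial q0 psi5 P \<longleftrightarrow> degree P \<le> 3 \<and>
      fps_nth (zeta_series q0 5 P) 3 = const_xy (1 / complex_of_real (q0 - 1)) * (psi5 - var_x ^ 5)"
    \<comment> \<open>By invariance the transform is \<open>psi5\<close> itself, so both exponents
      equal 2 and the degree bound is 3.\<close>
    unfolding is_zeta_polynomial_def act_sigma_psi5
    using enumerator_form_psi5_iff by fastforce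
  also have "\<dots> \<longleftrightarrow> P = zeta_psi5"
  proof
    assume *: "degree P \<le> 3 \<and>
      fps_nth (zeta_series q0 5 P) 3 = const_xy (1 / complex_of_real (q0 - 1)) * (psi5 - var_x ^ 5)"
    show "P = zeta_psi5"
    proof (rule poly_eqI)
      fix k :: nat
      consider "k = 0" | "k = 1" | "k = 2" | "k = 3" | "k > 3"
        by linarith
      then show "coeff P k = coeff zeta_psi5 k"
        using * unfolding zeta_equation_iff
        by cases (auto simp: zeta_psi5_def coeff_eq_0 eval_nat_numeral coeff_pCons split: nat.split)
    qed
  next
    assume "P = zeta_psi5"
    then show "degree P \<le> 3 \<and>
      fps_nth (zeta_series q0 5 P) 3 = const_xy (1 / complex_of_real (q0 - 1)) * (psi5 - var_x ^ 5)"
      unfolding zeta_equation_iff by (simp add: zeta_psi5_def eval_nat_numeral)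
  qed
  finally show ?thesis .
qed

lemma zeta_polynomial_psi5: "zeta_polynomial q0 psi5 = zeta_psi5"
  by (simp add: zeta_polynomial_def is_zeta_polynomial_psi5_iff)

section \<open>A root off the circle\<close>

lemma zeta_psi5_root_off_circle:
  obtains T where "poly zeta_psi5 T = 0" "cmod T \<noteq> 1 / sqrt q0"
proof -
  define m where "m = (5 + sqrt 5) / 2"
  have "m > 2"
    by (simp add: m_def add_pos_pos)
  then have "m ^ 2 \<ge> 2 ^ 2"
    by (intro power_mono) auto
  \<comment> \<open>The larger root of the quadratic factor; it is at least m / 2, hence exceeds
    1.\<close>
  define t where "t = (m + sqrt (m ^ 2 - 4)) / 2"
  have "sqrt (m ^ 2 - 4) ^ 2 = m ^ 2 - 4"
    using \<open>m ^ 2 \<ge> 2 ^ 2\<close> by simp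
  then have "t ^ 2 - m * t + 1 = 0"
    by (simp add: t_def power2_eq_square field_simps)
  moreover have "sqrt (m ^ 2 - 4) \<ge> 0"
    using \<open>m ^ 2 \<ge> 2 ^ 2\<close> by simp
  then have "t > 1"
    using \<open>m > 2\<close> add_strict_increasing2 [of _ 2 m] by (simp add: t_def del: real_sqrt_ge_0_iff)
  \<comment> \<open>By \<open>inverse_sqrt_q0\<close> this undoes the rescaling: T = t / sqrt q0,
    which lies outside the circle because t > 1.\<close>
  define T where "T = (sqrt 5 - 1) / 4 * t"
  have "- 1 + (4 + 2 * sqrt 5) * T + (14 + 6 * sqrt 5) * T ^ 2 - (16 + 8 * sqrt 5) * T ^ 3
      = - (t + 1) * (t ^ 2 - m * t + 1)"
  proof -
    have "sqrt 5 * (sqrt 5 * c) = 5 * c" for c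
      by (simp flip: mult.assoc)
    then show ?thesis
      unfolding T_def m_def
      by (simp add: add_divide_distrib diff_divide_distrib algebra_simps eval_nat_numeral)
  qed
  ultimately have "- 1 + (4 + 2 * sqrt 5) * T + (14 + 6 * sqrt 5) * T ^ 2 - (16 + 8 * sqrt 5) * T ^ 3 = 0"
    by simp
  then have "complex_of_real (- 1 + (4 + 2 * sqrt 5) * T + (14 + 6 * sqrt 5) * T ^ 2 - (16 + 8 * sqrt 5) * T ^ 3) = 0"
    by (simp only: of_real_0)
  then have "poly zeta_psi5 (complex_of_real T) = 0"
    by (simp add: zeta_psi5_def eval_nat_numeral algebra_simps)
  moreover have "cmod (complex_of_real T) \<noteq> 1 / sqrt q0"
  proof -
    have "(sqrt 5 - 1) / 4 > 0"
      by simp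
    then have "T > (sqrt 5 - 1) / 4"
      using mult_strict_left_mono [OF \<open>t > 1\<close>, of "(sqrt 5 - 1) / 4"] by (simp only: T_def mult_1_right)
    with \<open>(sqrt 5 - 1) / 4 > 0\<close> show ?thesis
      by (simp only: inverse_sqrt_q0 norm_of_real)
  qed
  ultimately show ?thesis
    using that by blast
qed

theorem theorem3p2:
  shows "extremal psi5 \<and>
    (\<exists>!P. is_zeta_polynomial q0 psi5 P) \<and>
    \<not> satisfies_RH q0 psi5 \<and>
    (\<exists>T :: complex. poly (zeta_polynomial q0 psi5) T = 0 \<and> cmod T \<noteq> 1 / sqrt q0)"
  using extremal_psi5 zeta_psi5_root_off_circle
  unfolding is_zeta_polynomial_psi5_iff satisfies_RH_def zeta_polynomial_psi5
  by blast

end
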